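(* Let $t$ be an integer with $t\geq 2$, and let $F$ be a forest with $\Delta_1(F)+2\Delta_2(F)\leq \binom{t+2}{2}+2$. Then $f_3(F)\leq t$.
   Context: All graphs are finite, simple, and undirected; $n(G)$ denotes the order of $G$. For a graph $G$ of order $n$ with degree sequence $d_1\geq d_2\geq\cdots\geq d_n$, put $\Delta_i(G)=d_i$ for $i\in\{1,\ldots,n\}$; a hypothesis involving $\Delta_i(G)$ presupposes $n(G)\geq i$. For an integer $k\geq 2$ and a graph $G$, $f_k(G)$ is the minimum cardinality of a set $X$ of vertices of $G$ such that $G-X$ either has at least $k$ vertices whose degree in $G-X$ equals the maximum degree of $G-X$, or has order less than $k$. *)

theory Defs
  imports "Graph_Theory.Digraph_Component" "HOL-Library.Multiset"
begin

text \<open>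
  A finite simple undirected graph is an instance of the locale \<open>graph\<close>: a finite, symmetric
  digraph without loops and parallel arcs. An undirected edge \<open>uv\<close> is the pair of opposite
  arcs from \<open>u\<close> to \<open>v\<close> and from \<open>v\<close> to \<open>u\<close>, so
  the degree of a vertex is its \<open>out_degree\<close>.
\<close>

text \<open>
  The library constant \<open>forest\<close> is not suitable for this encoding: it forbids all directed
  cycles, and every undirected edge gives a directed cycle of length 2. In a graph without parallel
  arcs, the undirected cycles are the directed cycles of length at least 3.
\<close>

definition undirected_forest :: "('a, 'b) pre_digraph \<Rightarrow> bool" where
  "undirected_forest G \<longleftrightarrow> graph G \<and> \<not> (\<exists>p. pre_digraph.cycle G p \<and> 3 \<le> length p)"

definition degree_sequence :: "('a, 'b) pre_digraph \<Rightarrow> nat list" where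
  "degree_sequence G =
     rev (sorted_list_of_multiset (image_mset (out_degree G) (mset_set (verts G))))"

text \<open>Indices start at 1; the value is only meaningful for \<open>1 \<le> i \<le> card (verts G)\<close>.\<close>

definition Delta :: "nat \<Rightarrow> ('a, 'b) pre_digraph \<Rightarrow> nat" where
  "Delta i G = degree_sequence G ! (i - 1)"

definition max_degree :: "('a, 'b) pre_digraph \<Rightarrow> nat" where
  "max_degree G = Max (out_degree G ` verts G)"

definition delete_verts :: "('a, 'b) pre_digraph \<Rightarrow> 'a set \<Rightarrow> ('a, 'b) pre_digraph" where
  "delete_verts G X = G \<restriction> (verts G - X)"

text \<open>
  For \<open>1 \<le> k\<close> the first disjunct is false when \<open>H\<close> has no vertices, so the
  unspecified maximum of the empty set plays no role.
\<close>

definition max_degree_repeated_or_small :: "nat \<Rightarrow> ('a, 'b) pre_digraph \<Rightarrow> bool" where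
  "max_degree_repeated_or_small k H \<longleftrightarrow>
     k \<le> card {v \<in> verts H. out_degree H v = max_degree H} \<or> card (verts H) < k"

text \<open>For finite \<open>G\<close> and \<open>1 \<le> k\<close> the minimum exists, since \<open>X = verts G\<close> is admissible.\<close>

definition f_param :: "nat \<Rightarrow> ('a, 'b) pre_digraph \<Rightarrow> nat" where
  "f_param k G =
     (LEAST m. \<exists>X \<subseteq> verts G. card X = m \<and> max_degree_repeated_or_small k (delete_verts G X))"

end

theory Submission
  imports Defs
begin

text \<open>
  Let \<open>d\<^sub>1 \<ge> d\<^sub>2 \<ge> d\<^sub>3\<close> be the three largest degrees, attained at \<open>v\<^sub>1\<close>, \<open>v\<^sub>2\<close>, \<open>v\<^sub>3\<close>. There are two
  ways to make progress. One can level \<open>v\<^sub>1\<close> and \<open>v\<^sub>2\<close> down to \<open>d\<^sub>3\<close> by deleting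
  \<open>(d\<^sub>1 - d\<^sub>3) + (d\<^sub>2 - d\<^sub>3)\<close> of their neighbours. Or one can delete \<open>v\<^sub>1\<close>, after which the two largest
  degrees are at most \<open>d\<^sub>2\<close> and \<open>d\<^sub>3\<close>. The quantity \<open>d\<^sub>1 + 2 d\<^sub>2\<close> ties these options together, because
  \<open>d\<^sub>2 + 2 d\<^sub>3 = (d\<^sub>1 + 2 d\<^sub>2) - (d\<^sub>1 + d\<^sub>2 - 2 d\<^sub>3)\<close>: if levelling costs more than \<open>t\<close>, then deleting
  \<open>v\<^sub>1\<close> lowers \<open>d\<^sub>1 + 2 d\<^sub>2\<close> by at least \<open>t + 1\<close>, which is the difference of the bounds
  \<open>(t+2 choose 2) + 2\<close> and \<open>(t+1 choose 2) + 2\<close>. So the proof is by induction on \<open>t\<close>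
  (\<open>few_deletions_suffice\<close>), starting at \<open>t = 2\<close>, where levelling is cheap enough whenever \<open>d\<^sub>3 \<ge> 2\<close>.

  Levelling needs neighbours of \<open>v\<^sub>1\<close> whose deletion does not affect \<open>v\<^sub>2\<close> and \<open>v\<^sub>3\<close>, and vice versa.
  Without triangles and 4-cycles, at most one neighbour of \<open>v\<^sub>1\<close> is \<open>v\<^sub>2\<close> or adjacent to \<open>v\<^sub>2\<close>, and
  likewise for \<open>v\<^sub>3\<close>, so all but two neighbours of \<open>v\<^sub>1\<close> are harmless. This is enough when
  \<open>d\<^sub>3 \<ge> 2\<close> (\<open>level_to_third_degree\<close>).

  If \<open>d\<^sub>3 \<le> 1\<close>, deleting one or two vertices leaves a graph of maximum degree at most 1, and such a
  graph fails the requirement only if it has exactly one edge (\<open>bad_matching_single_edge\<close>).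
  Removing an end of that edge then finishes, and the total is at most \<open>t\<close>: the total is 3
  only if \<open>d\<^sub>2 \<ge> 3\<close>, which the degree bound forbids for \<open>t = 2\<close>; for \<open>d\<^sub>2 = 2\<close> two deletions are enough
  (\<open>delete_two_if_second_degree_two\<close>).

  The whole argument deletes vertices from one fixed graph, so it is carried out for a neighbourhood
  function and a shrinking vertex set; no subgraphs are formed.
\<close>

section \<open>Degrees relative to a set of remaining vertices\<close>

definition deg_in :: "('a \<Rightarrow> 'a set) \<Rightarrow> 'a set \<Rightarrow> 'a \<Rightarrow> nat" where
  "deg_in N S v = card (N v \<inter> S)"

definition three_max_or_small :: "('a \<Rightarrow> 'a set) \<Rightarrow> 'a set \<Rightarrow> bool" where
  "three_max_or_small N S \<longleftrightarrow>
     3 \<le> card {v \<in> S. deg_in N S v = Max (deg_in N S ` S)} \<or> card S < 3"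

lemma three_max_or_smallI:
  assumes "finite S" "T \<subseteq> S" "3 \<le> card T"
    and "\<And>v. v \<in> T \<Longrightarrow> deg_in N S v = m" "\<And>v. v \<in> S \<Longrightarrow> deg_in N S v \<le> m"
  shows "three_max_or_small N S"
proof -
  from assms(3) have "T \<noteq> {}" by auto
  then obtain x where "x \<in> T" by blast
  then have "m \<in> deg_in N S ` S" using assms(2,4) by (metis imageI subsetD)
  then have "Max (deg_in N S ` S) = m"
    using assms(1,5) by (intro Max_eqI) auto
  then have "T \<subseteq> {v \<in> S. deg_in N S v = Max (deg_in N S ` S)}"
    using assms(2,4) by auto
  then have "card T \<le> card {v \<in> S. deg_in N S v = Max (deg_in N S ` S)}"
    using assms(1) by (intro card_mono) auto
  then show ?thesis using assms(3) by (auto simp: three_max_or_small_def)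
qed

lemma deg_in_mono: "finite T \<Longrightarrow> S \<subseteq> T \<Longrightarrow> deg_in N S v \<le> deg_in N T v"
  unfolding deg_in_def by (intro card_mono) auto

lemma deg_in_pos: "finite S \<Longrightarrow> w \<in> N v \<Longrightarrow> w \<in> S \<Longrightarrow> 1 \<le> deg_in N S v"
  unfolding deg_in_def by (metis IntI One_nat_def Suc_leI card_gt_0_iff empty_iff finite_Int)

lemma deg_in_neq_0E:
  assumes "deg_in N S v \<noteq> 0"
  obtains w where "w \<in> N v" "w \<in> S"
  using assms unfolding deg_in_def by (metis Int_iff card.empty equals0I)

lemma deg_in_le_1D:
  "finite S \<Longrightarrow> deg_in N S v \<le> 1 \<Longrightarrow> x \<in> N v \<inter> S \<Longrightarrow> y \<in> N v \<inter> S \<Longrightarrow> x = y"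
  unfolding deg_in_def by (metis One_nat_def card_le_Suc0_iff_eq finite_Int)

lemma obtain_maximizer:
  fixes f :: "'a \<Rightarrow> nat"
  assumes "finite A" "A \<noteq> {}"
  obtains x where "x \<in> A" "\<And>y. y \<in> A \<Longrightarrow> f y \<le> f x"
proof -
  have "Max (f ` A) \<in> f ` A" using assms by (intro Max_in) auto
  then obtain x where "x \<in> A" "f x = Max (f ` A)" by auto
  then show ?thesis using assms that by simp
qed

lemma edgeless_three_max_or_small:
  assumes "finite S" "\<And>v. v \<in> S \<Longrightarrow> deg_in N S v = 0"
  shows "three_max_or_small N S"
proof (cases "card S < 3")
  case True
  then show ?thesis by (simp add: three_max_or_small_def)
next
  case False
  then show ?thesis using assms by (intro three_max_or_smallI[of S S N 0]) auto
qed

locale girth_at_least_five =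
  fixes N :: "'a \<Rightarrow> 'a set"
  assumes nbr_sym: "u \<in> N v \<Longrightarrow> v \<in> N u"
    and nbr_irrefl: "v \<notin> N v"
    and no_triangle: "u \<in> N v \<Longrightarrow> w \<in> N u \<Longrightarrow> w \<notin> N v"
    and no_four_cycle:
      "x \<in> N u \<Longrightarrow> y \<in> N u \<Longrightarrow> x \<in> N v \<Longrightarrow> y \<in> N v \<Longrightarrow> u \<noteq> v \<Longrightarrow> x = y"
begin

section \<open>At most one vertex of degree at least two besides the largest\<close>

text \<open>
  In a graph of maximum degree at most 1, every edge contributes two vertices of degree 1. No edge
  means that all degrees are 0, and two edges give four vertices of maximum degree.
\<close>
lemma bad_matching_single_edge:
  assumes fin: "finite S" and le1: "\<And>v. v \<in> S \<Longrightarrow> deg_in N S v \<le> 1"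
    and bad: "\<not> three_max_or_small N S"
  obtains x y where "x \<in> S" "y \<in> S" "y \<in> N x" "{v \<in> S. deg_in N S v = 1} = {x, y}"
proof -
  let ?T = "{v \<in> S. deg_in N S v = 1}"
  obtain x where x: "x \<in> S" "deg_in N S x = 1"
    using edgeless_three_max_or_small[OF fin] bad le1 by (metis le_antisym less_one not_less)
  then obtain y where y: "N x \<inter> S = {y}"
    unfolding deg_in_def by (meson card_1_singletonE)
  then have yx: "y \<in> S" "y \<in> N x" by auto
  then have "1 \<le> deg_in N S y"
    using x fin nbr_sym by (blast intro: deg_in_pos)
  then have "y \<in> ?T" using le1[of y] yx by auto
  moreover have "x \<noteq> y" using yx nbr_irrefl by auto
  moreover have "card ?T < 3"
    using three_max_or_smallI[of S ?T N 1] fin le1 bad by fastforce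
  ultimately have "?T = {x, y}"
    using x fin by (intro card_seteq[symmetric]) auto
  then show ?thesis using that x yx by blast
qed

lemma matching_delete_at_most_one:
  assumes fin: "finite S" and le1: "\<And>v. v \<in> S \<Longrightarrow> deg_in N S v \<le> 1"
  obtains X where "X \<subseteq> S" "card X \<le> 1" "three_max_or_small N (S - X)"
proof (cases "three_max_or_small N S")
  case True
  then show ?thesis using that[of "{}"] by simp
next
  case False
  then obtain x y where xy: "x \<in> S" "y \<in> S" "y \<in> N x" "{v \<in> S. deg_in N S v = 1} = {x, y}"
    using bad_matching_single_edge fin le1 by blast
  have "deg_in N (S - {x}) v = 0" if v: "v \<in> S - {x}" for v
  proof (rule ccontr)
    assume "deg_in N (S - {x}) v \<noteq> 0"
    then obtain w where w: "w \<in> N v" "w \<in> S" "w \<noteq> x"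
      by (rule deg_in_neq_0E) auto
    have "deg_in N S v = 1"
      using deg_in_pos[OF fin, of w N v] w le1[of v] v by simp
    then have "v = y" using xy v by blast
    then have "w = x"
      using deg_in_le_1D[OF fin, of N v w x] le1[of v] v w xy nbr_sym by blast
    then show False using w by simp
  qed
  then have "three_max_or_small N (S - {x})"
    using fin by (intro edgeless_three_max_or_small) auto
  then show ?thesis using that[of "{x}"] xy by simp
qed

text \<open>
  Deleting \<open>v\<^sub>1\<close> and one further neighbour of \<open>v\<^sub>2\<close> (or only \<open>v\<^sub>1\<close>, if it is a neighbour) leaves \<open>v\<^sub>2\<close>
  with degree 1. If that fails, then the only remaining edge is at \<open>v\<^sub>2\<close>, so every edge of the
  original graph meets \<open>v\<^sub>1\<close> or \<open>v\<^sub>2\<close>, and deleting these two leaves no edge at all.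
\<close>
lemma delete_two_if_second_degree_two:
  assumes fin: "finite W" and W: "v1 \<in> W" "v2 \<in> W" "v1 \<noteq> v2"
    and d2: "deg_in N W v2 = 2"
    and le1: "\<And>v. v \<in> W \<Longrightarrow> v \<noteq> v1 \<Longrightarrow> v \<noteq> v2 \<Longrightarrow> deg_in N W v \<le> 1"
  obtains X where "X \<subseteq> W" "card X \<le> 2" "three_max_or_small N (W - X)"
proof -
  obtain u where u: "u \<in> N v2 \<inter> W" "v1 \<in> N v2 \<Longrightarrow> u = v1"
  proof (cases "v1 \<in> N v2")
    case True
    then show ?thesis using that W by blast
  next
    case False
    have "N v2 \<inter> W \<noteq> {}" using d2 by (auto simp: deg_in_def)
    then show ?thesis using that False by blast
  qed
  let ?S = "W - {v1, u}"
  have "N v2 \<inter> ?S = (N v2 \<inter> W) - {u}" using u by auto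
  then have d2S: "deg_in N ?S v2 = 1"
    using d2 u fin by (simp add: deg_in_def)
  have v2S: "v2 \<in> ?S" using W u nbr_irrefl by auto
  have le1S: "deg_in N ?S v \<le> 1" if "v \<in> ?S" for v
    using that le1[of v] d2S deg_in_mono[OF fin, of ?S N v] by (cases "v = v2") auto
  have card2: "card {v1, a} \<le> 2" for a
    by (simp add: card_insert_if)
  show ?thesis
  proof (cases "three_max_or_small N ?S")
    case True
    then show ?thesis using that[of "{v1, u}"] card2 W u by auto
  next
    case False
    obtain x y where xy: "{v \<in> ?S. deg_in N ?S v = 1} = {x, y}"
      by (rule bad_matching_single_edge[of ?S]) (use fin le1S False in auto)
    have "deg_in N (W - {v1, v2}) v = 0" if v: "v \<in> W - {v1, v2}" for v
    proof (rule ccontr)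
      assume "deg_in N (W - {v1, v2}) v \<noteq> 0"
      then obtain w where w: "w \<in> N v" "w \<in> W - {v1, v2}"
        by (rule deg_in_neq_0E) auto
      have "v \<noteq> w" using w nbr_irrefl by auto
      \<comment> \<open>The vertex \<open>u\<close> has no neighbour in \<open>W\<close> besides \<open>v2\<close>, unless it is \<open>v1\<close>.\<close>
      have not_u: False if "a = u" "a \<in> W - {v1, v2}" "b \<in> N a" "b \<in> W - {v1, v2}" for a b
      proof -
        have "u \<noteq> v1" "u \<noteq> v2" using that by auto
        then have "deg_in N W u \<le> 1" using le1 u(1) by blast
        moreover have "v2 \<in> N u" using u(1) nbr_sym by blast
        ultimately have "b = v2" using deg_in_le_1D[OF fin, of N u b v2] that W by blast
        then show False using that(4) by simp
      qed
      have S: "v \<in> ?S" "w \<in> ?S"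
        using not_u[of v w] not_u[of w v] v w nbr_sym[OF w(1)] by auto
      have "deg_in N ?S v = 1" "deg_in N ?S w = 1"
        using deg_in_pos[of ?S w N v] deg_in_pos[of ?S v N w] le1S[OF S(1)] le1S[OF S(2)]
          S w(1) nbr_sym[OF w(1)] fin by (simp_all add: le_antisym)
      then have "v \<in> {x, y}" "w \<in> {x, y}" "v2 \<in> {x, y}"
        unfolding xy[symmetric] using S v2S d2S by simp_all
      then show False using v w \<open>v \<noteq> w\<close> by auto
    qed
    then have "three_max_or_small N (W - {v1, v2})"
      using fin by (intro edgeless_three_max_or_small) auto
    then show ?thesis using that[of "{v1, v2}"] card2 W by auto
  qed
qed

lemma third_degree_at_most_one:
  assumes fin: "finite W" and W: "v1 \<in> W" "v2 \<in> W" "v1 \<noteq> v2"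
    and le1: "\<And>v. v \<in> W \<Longrightarrow> v \<noteq> v1 \<Longrightarrow> v \<noteq> v2 \<Longrightarrow> deg_in N W v \<le> 1"
  obtains X where "X \<subseteq> W" "card X \<le> (if deg_in N W v2 \<le> 2 then 2 else 3)"
    "three_max_or_small N (W - X)"
proof -
  have mono: "deg_in N (W - Y) v \<le> deg_in N W v" for Y v
    using fin by (intro deg_in_mono) auto
  \<comment> \<open>Once the vertices that could have degree at least 2 are gone, one more deletion is enough.\<close>
  have reduce: "\<exists>X\<subseteq>W. card X \<le> card Y + 1 \<and> three_max_or_small N (W - X)"
    if Y: "Y \<subseteq> W" "\<And>v. v \<in> W - Y \<Longrightarrow> deg_in N W v \<le> 1" for Y
  proof -
    obtain Z where Z: "Z \<subseteq> W - Y" "card Z \<le> 1" "three_max_or_small N (W - Y - Z)"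
    proof (rule matching_delete_at_most_one[of "W - Y"])
      show "deg_in N (W - Y) v \<le> 1" if "v \<in> W - Y" for v
        using mono[of Y v] Y(2)[OF that] by linarith
    qed (use fin in auto)
    have "card (Y \<union> Z) \<le> card Y + 1"
      using card_Un_le[of Y Z] Z(2) by linarith
    moreover have "W - Y - Z = W - (Y \<union> Z)" by auto
    ultimately show ?thesis using Z Y(1) by (metis Diff_subset Un_least subset_trans)
  qed
  consider "deg_in N W v2 \<le> 1" | "deg_in N W v2 = 2" | "3 \<le> deg_in N W v2" by linarith
  then show ?thesis
  proof cases
    case 1
    then show ?thesis using reduce[of "{v1}"] that W le1 by force
  next
    case 2
    then show ?thesis using delete_two_if_second_degree_two[OF fin W _ le1] that by auto
  next
    case 3
    then show ?thesis using reduce[of "{v1, v2}"] that W le1 by force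
  qed
qed

section \<open>Levelling the two largest degrees\<close>

definition private_nbrs :: "'a set \<Rightarrow> 'a \<Rightarrow> 'a \<Rightarrow> 'a \<Rightarrow> 'a set" where
  "private_nbrs W v p q = {w \<in> N v \<inter> W. w \<notin> {p, q} \<union> N p \<union> N q}"

text \<open>
  Two neighbours of \<open>v\<close> that both lie in \<open>{p} \<union> N p\<close> close a triangle or a 4-cycle through
  \<open>v\<close> and \<open>p\<close>.
\<close>
lemma shared_nbr_unique:
  assumes "v \<noteq> p" "x \<in> N v" "x \<in> {p} \<union> N p" "y \<in> N v" "y \<in> {p} \<union> N p"
  shows "x = y"
  using assms no_triangle[of p v] no_four_cycle[of x v y p] by blast

lemma deg_in_le_private_nbrs:
  assumes fin: "finite W" and "v \<noteq> p" "v \<noteq> q"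
  shows "deg_in N W v \<le> card (private_nbrs W v p q) + 2"
proof -
  define shared where "shared r = {w \<in> N v \<inter> W. w \<in> {r} \<union> N r}" for r
  have card1: "card (shared r) \<le> 1" if "v \<noteq> r" for r
    using fin shared_nbr_unique[OF that]
    by (auto simp: shared_def card_le_Suc0_iff_eq)
  have "N v \<inter> W \<subseteq> private_nbrs W v p q \<union> (shared p \<union> shared q)"
    by (auto simp: shared_def private_nbrs_def)
  then have "deg_in N W v \<le> card (private_nbrs W v p q \<union> (shared p \<union> shared q))"
    unfolding deg_in_def using fin
    by (intro card_mono) (auto simp: shared_def private_nbrs_def)
  also have "\<dots> \<le> card (private_nbrs W v p q) + (card (shared p) + card (shared q))"
    by (meson add_left_mono card_Un_le le_trans)
  finally show ?thesis using card1[OF assms(2)] card1[OF assms(3)] by linarith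
qed

text \<open>
  Delete only neighbours of \<open>v\<^sub>1\<close> that are neither equal nor adjacent to \<open>v\<^sub>2\<close> or \<open>v\<^sub>3\<close>, and
  symmetrically for \<open>v\<^sub>2\<close>; then the three degrees change independently. There are enough such
  neighbours because at most two are excluded and \<open>d\<^sub>3 \<ge> 2\<close> of them may stay. No other degree
  exceeds \<open>d\<^sub>3\<close>, so afterwards \<open>d\<^sub>3\<close> is the maximum degree.
\<close>
lemma level_to_third_degree:
  assumes fin: "finite W" and W: "v1 \<in> W" "v2 \<in> W" "v3 \<in> W"
    and ne: "v1 \<noteq> v2" "v1 \<noteq> v3" "v2 \<noteq> v3"
    and ge: "deg_in N W v3 \<le> deg_in N W v1" "deg_in N W v3 \<le> deg_in N W v2"
    and le: "\<And>v. v \<in> W \<Longrightarrow> v \<noteq> v1 \<Longrightarrow> v \<noteq> v2 \<Longrightarrow> deg_in N W v \<le> deg_in N W v3"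
    and d3: "2 \<le> deg_in N W v3"
  obtains X where "X \<subseteq> W" "card X + 2 * deg_in N W v3 \<le> deg_in N W v1 + deg_in N W v2"
    "three_max_or_small N (W - X)"
proof -
  let ?d = "deg_in N W"
  have "?d v1 - ?d v3 \<le> card (private_nbrs W v1 v2 v3)"
    using deg_in_le_private_nbrs[OF fin, of v1 v2 v3] ne d3 by linarith
  then obtain A where A: "A \<subseteq> private_nbrs W v1 v2 v3" "card A = ?d v1 - ?d v3"
    by (meson obtain_subset_with_card_n)
  have "?d v2 - ?d v3 \<le> card (private_nbrs W v2 v1 v3)"
    using deg_in_le_private_nbrs[OF fin, of v2 v1 v3] ne d3 by fastforce
  then obtain B where B: "B \<subseteq> private_nbrs W v2 v1 v3" "card B = ?d v2 - ?d v3"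
    by (meson obtain_subset_with_card_n)
  let ?X = "A \<union> B"
  have AW: "A \<subseteq> N v1 \<inter> W" "A \<inter> ({v2, v3} \<union> N v2 \<union> N v3) = {}"
    and BW: "B \<subseteq> N v2 \<inter> W" "B \<inter> ({v1, v3} \<union> N v1 \<union> N v3) = {}"
    using A(1) B(1) by (auto simp: private_nbrs_def)
  have finA: "finite A" and finB: "finite B"
    using AW BW fin by (meson finite_Int finite_subset)+
  have split: "N v1 \<inter> (W - ?X) = N v1 \<inter> W - A" "N v2 \<inter> (W - ?X) = N v2 \<inter> W - B"
    "N v3 \<inter> (W - ?X) = N v3 \<inter> W"
    using AW BW by auto
  have deg: "deg_in N (W - ?X) v1 = ?d v3" "deg_in N (W - ?X) v2 = ?d v3"
    "deg_in N (W - ?X) v3 = ?d v3"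
    using split card_Diff_subset[OF finA AW(1)]
      card_Diff_subset[OF finB BW(1)] A(2) B(2) ge
    by (simp_all add: deg_in_def)
  have "three_max_or_small N (W - ?X)"
  proof (rule three_max_or_smallI[where T = "{v1, v2, v3}" and m = "?d v3"])
    show "{v1, v2, v3} \<subseteq> W - ?X" using AW BW W nbr_irrefl by auto
    show "deg_in N (W - ?X) v \<le> ?d v3" if "v \<in> W - ?X" for v
      using that deg le[of v] deg_in_mono[OF fin, of "W - ?X" N v]
      by (cases "v = v1"; cases "v = v2") auto
  qed (use fin ne deg in auto)
  moreover have "?X \<subseteq> W" using AW BW by auto
  moreover have "card ?X + 2 * ?d v3 \<le> ?d v1 + ?d v2"
    using card_Un_le[of A B] A(2) B(2) ge by linarith
  ultimately show ?thesis using that by blast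
qed

section \<open>The induction\<close>

text \<open>
  The two largest degrees enter only through upper bounds \<open>a\<close> for one vertex and \<open>b\<close> for all others.
  In this form the hypothesis passes to the graph without a vertex of maximum degree, whose true
  degrees may be smaller.
\<close>
lemma few_deletions_suffice:
  assumes "finite W" "v \<in> W" "deg_in N W v \<le> a"
    and "\<And>u. u \<in> W \<Longrightarrow> u \<noteq> v \<Longrightarrow> deg_in N W u \<le> b"
    and "b \<le> a" "a + 2 * b \<le> ((t + 2) choose 2) + 2" "2 \<le> t"
  shows "\<exists>X\<subseteq>W. card X \<le> t \<and> three_max_or_small N (W - X)"
  using assms
proof (induction t arbitrary: W v a b)
  case 0
  then show ?case by simp
next
  case (Suc t)
  let ?d = "deg_in N W"
  note fin = Suc.prems(1)
  have choose: "(Suc t + 2) choose 2 = ((t + 2) choose 2) + (t + 2)"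
    by (simp add: numeral_2_eq_2)
  show ?case
  proof (cases "card W < 3")
    case True
    then show ?thesis by (intro exI[of _ "{}"]) (simp add: three_max_or_small_def)
  next
    case False
    then have card3: "3 \<le> card W" by simp
    obtain v1 where v1: "v1 \<in> W" "\<And>u. u \<in> W \<Longrightarrow> ?d u \<le> ?d v1"
      using obtain_maximizer[OF fin, of ?d] Suc.prems(2) by blast
    have "card (W - {v1}) \<ge> 2" using card3 v1 by simp
    then have "W - {v1} \<noteq> {}" by force
    then obtain v2 where v2: "v2 \<in> W - {v1}" "\<And>u. u \<in> W - {v1} \<Longrightarrow> ?d u \<le> ?d v2"
      using obtain_maximizer[of "W - {v1}" ?d] fin by blast
    have "card (W - {v1, v2}) \<ge> 1"
      using card3 diff_card_le_card_Diff[of "{v1, v2}" W] v2(1) by (auto simp: card_insert_if)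
    then have "W - {v1, v2} \<noteq> {}" by force
    then obtain v3 where v3: "v3 \<in> W - {v1, v2}" "\<And>u. u \<in> W - {v1, v2} \<Longrightarrow> ?d u \<le> ?d v3"
      using obtain_maximizer[of "W - {v1, v2}" ?d] fin by blast
    have d12: "?d v2 \<le> ?d v1" and d23: "?d v3 \<le> ?d v2" using v1 v2 v3 by auto
    have ab: "?d v1 + 2 * ?d v2 \<le> a + 2 * b"
    proof (cases "v1 = v")
      case True
      then show ?thesis using Suc.prems(3) Suc.prems(4)[of v2] v2 by auto
    next
      case False
      then show ?thesis using Suc.prems(4)[of v1] v1(1) d12 Suc.prems(5) by linarith
    qed
    consider "?d v3 \<le> 1" | "2 \<le> ?d v3" "?d v1 + ?d v2 \<le> Suc t + 2 * ?d v3"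
      | "2 \<le> ?d v3" "Suc (Suc t) + 2 * ?d v3 \<le> ?d v1 + ?d v2" by linarith
    then show ?thesis
    proof cases
      case 1
      have le1: "?d u \<le> 1" if "u \<in> W" "u \<noteq> v1" "u \<noteq> v2" for u
        using v3(2)[of u] that 1 by simp
      obtain X where X: "X \<subseteq> W" "card X \<le> (if ?d v2 \<le> 2 then 2 else 3)"
        "three_max_or_small N (W - X)"
        by (rule third_degree_at_most_one[OF fin v1(1) _ _ le1]) (use v2(1) in auto)
      have "3 \<le> Suc t" if "\<not> ?d v2 \<le> 2"
      proof (rule ccontr)
        \<comment> \<open>If \<open>Suc t = 2\<close>, then \<open>?d v1 + 2 * ?d v2 \<le> 8\<close>, but three times the second degree is 9 or more.\<close>
        assume "\<not> 3 \<le> Suc t"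
        then have "Suc t = 2" using Suc.prems(7) by simp
        then have "a + 2 * b \<le> 8" using Suc.prems(6) by (simp add: numeral_eq_Suc)
        then show False using ab d12 that by linarith
      qed
      then show ?thesis using X Suc.prems(7) by (intro exI[of _ X]) (auto split: if_splits)
    next
      case 2
      obtain X where "X \<subseteq> W" "card X + 2 * ?d v3 \<le> ?d v1 + ?d v2" "three_max_or_small N (W - X)"
        by (rule level_to_third_degree[OF fin, of v1 v2 v3]) (use v1(1) v2(1) v3 d12 d23 2(1) in auto)
      then show ?thesis using 2(2) by (intro exI[of _ X]) auto
    next
      case 3
      \<comment> \<open>If \<open>Suc t = 2\<close>, the degree bound forces \<open>?d v2 = ?d v3 = 2\<close> and \<open>?d v1 \<le> 4\<close>, so levelling
        costs at most 2. Hence \<open>Suc t \<noteq> 2\<close> here, and the induction hypothesis applies.\<close>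
      have t: "2 \<le> t"
      proof (rule ccontr)
        assume "\<not> 2 \<le> t"
        then have "t = 1" using Suc.prems(7) by simp
        then have "a + 2 * b \<le> 8" using Suc.prems(6) by (simp add: numeral_eq_Suc)
        then show False using ab d12 d23 3 \<open>t = 1\<close> by linarith
      qed
      let ?W = "W - {v1}"
      have mono: "deg_in N ?W u \<le> ?d u" for u
        using fin by (intro deg_in_mono) auto
      have "\<exists>X\<subseteq>?W. card X \<le> t \<and> three_max_or_small N (?W - X)"
      proof (rule Suc.IH[of ?W v2 "?d v2" "?d v3"])
        show "deg_in N ?W u \<le> ?d v3" if "u \<in> ?W" "u \<noteq> v2" for u
          using that v3(2)[of u] mono[of u] by auto
        show "?d v2 + 2 * ?d v3 \<le> ((t + 2) choose 2) + 2"
          using 3 ab Suc.prems(6) choose by linarith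
      qed (use fin v2 mono d23 t in auto)
      then obtain X where X: "X \<subseteq> ?W" "card X \<le> t" "three_max_or_small N (?W - X)" by blast
      have "W - insert v1 X = ?W - X" by auto
      moreover have "card (insert v1 X) \<le> Suc t" using card_insert_le_m1[of "Suc t" X v1] X by simp
      ultimately show ?thesis using X v1 by (intro exI[of _ "insert v1 X"]) auto
    qed
  qed
qed

end

section \<open>Forests and their degree sequences\<close>

context graph
begin

lemma out_degree_delete_verts:
  assumes "v \<in> verts G" "v \<notin> X"
  shows "out_degree (delete_verts G X) v = deg_in (\<lambda>v. {w. v \<rightarrow>\<^bsub>G\<^esub> w}) (verts G - X) v"
proof -
  let ?E = "out_arcs (delete_verts G X) v"
  have "inj_on (head G) ?E"
    by (rule inj_onI, rule no_multi_arcs) (auto simp: delete_verts_def out_arcs_def arc_to_ends_def)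
  moreover have "head G ` ?E = {w. v \<rightarrow>\<^bsub>G\<^esub> w} \<inter> (verts G - X)"
    using assms by (auto simp: delete_verts_def out_arcs_def arcs_ends_conv)
  ultimately show ?thesis
    unfolding out_degree_def deg_in_def by (metis card_image)
qed

lemma max_degree_repeated_iff:
  "max_degree_repeated_or_small 3 (delete_verts G X) \<longleftrightarrow>
   three_max_or_small (\<lambda>v. {w. v \<rightarrow>\<^bsub>G\<^esub> w}) (verts G - X)"
proof -
  let ?H = "delete_verts G X" and ?d = "deg_in (\<lambda>v. {w. v \<rightarrow>\<^bsub>G\<^esub> w}) (verts G - X)"
  have V: "verts ?H = verts G - X" by (simp add: delete_verts_def)
  have d: "out_degree ?H v = ?d v" if "v \<in> verts G - X" for v
    using that out_degree_delete_verts by simp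
  have "max_degree ?H = Max (?d ` (verts G - X))"
    unfolding max_degree_def V using d by (metis (no_types, lifting) image_cong)
  moreover from this
  have "{v \<in> verts ?H. out_degree ?H v = max_degree ?H}
      = {v \<in> verts G - X. ?d v = Max (?d ` (verts G - X))}"
    using d V by auto
  ultimately show ?thesis
    unfolding max_degree_repeated_or_small_def three_max_or_small_def V by simp
qed

end

lemma forest_girth:
  assumes "undirected_forest G"
  shows "girth_at_least_five (\<lambda>v. {w. v \<rightarrow>\<^bsub>G\<^esub> w})"
proof -
  interpret graph G using assms by (simp add: undirected_forest_def)
  have no_cycle: "\<not> cycle p" if "3 \<le> length p" for p
    using assms that by (auto simp: undirected_forest_def)
  have sym: "v \<rightarrow>\<^bsub>G\<^esub> u" if "u \<rightarrow>\<^bsub>G\<^esub> v" for u v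
    using that sym_arcs by (rule arcs_ends_symmetric[rotated])
  have irrefl: "\<not> v \<rightarrow>\<^bsub>G\<^esub> v" for v using adj_not_same by blast
  have no3: False if t: "u \<rightarrow>\<^bsub>G\<^esub> v" "v \<rightarrow>\<^bsub>G\<^esub> w" "w \<rightarrow>\<^bsub>G\<^esub> u" for u v w
  proof -
    obtain e where e: "e \<in> arcs G" "tail G e = u" "head G e = v"
      using reachableE[OF t(1)] .
    obtain f where f: "f \<in> arcs G" "tail G f = v" "head G f = w"
      using reachableE[OF t(2)] .
    obtain g where g: "g \<in> arcs G" "tail G g = w" "head G g = u"
      using reachableE[OF t(3)] .
    have "u \<noteq> v" "v \<noteq> w" "w \<noteq> u" using t irrefl by auto
    then have "cycle [e, f, g]"
      unfolding cycle_def using e f g by (auto simp: awalk_def intro!: exI[of _ u])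
    then show False using no_cycle[of "[e, f, g]"] by simp
  qed
  have no4: "x = y"
    if q: "u \<rightarrow>\<^bsub>G\<^esub> x" "u \<rightarrow>\<^bsub>G\<^esub> y" "v \<rightarrow>\<^bsub>G\<^esub> x" "v \<rightarrow>\<^bsub>G\<^esub> y" "u \<noteq> v" for u v x y
  proof (rule ccontr)
    assume "x \<noteq> y"
    obtain e where e: "e \<in> arcs G" "tail G e = u" "head G e = x"
      using reachableE[OF q(1)] .
    obtain f where f: "f \<in> arcs G" "tail G f = x" "head G f = v"
      using reachableE[OF sym[OF q(3)]] .
    obtain g where g: "g \<in> arcs G" "tail G g = v" "head G g = y"
      using reachableE[OF q(4)] .
    obtain h where h: "h \<in> arcs G" "tail G h = y" "head G h = u"
      using reachableE[OF sym[OF q(2)]] .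
    have "u \<noteq> x" "u \<noteq> y" "v \<noteq> x" "v \<noteq> y" using q irrefl by auto
    then have "cycle [e, f, g, h]"
      unfolding cycle_def using e f g h \<open>x \<noteq> y\<close> \<open>u \<noteq> v\<close>
      by (auto simp: awalk_def intro!: exI[of _ u])
    then show False using no_cycle[of "[e, f, g, h]"] by simp
  qed
  show ?thesis
  proof
    show "w \<notin> {w. v \<rightarrow>\<^bsub>G\<^esub> w}" if "u \<in> {w. v \<rightarrow>\<^bsub>G\<^esub> w}" "w \<in> {w. u \<rightarrow>\<^bsub>G\<^esub> w}" for u v w
      using that no3[of v u w] sym[of v w] by auto
    show "x = y" if "x \<in> {w. u \<rightarrow>\<^bsub>G\<^esub> w}" "y \<in> {w. u \<rightarrow>\<^bsub>G\<^esub> w}" "x \<in> {w. v \<rightarrow>\<^bsub>G\<^esub> w}"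
      "y \<in> {w. v \<rightarrow>\<^bsub>G\<^esub> w}" "u \<noteq> v" for u v x y
      using that no4[of u x y v] by auto
  qed (use sym irrefl in auto)
qed

lemma degree_sequence_enumerates:
  assumes "finite (verts G)"
  obtains vs where "distinct vs" "set vs = verts G"
    "degree_sequence G = map (out_degree G) vs" "sorted_wrt (\<ge>) (map (out_degree G) vs)"
proof -
  obtain xs where xs: "set xs = verts G" "distinct xs"
    using finite_distinct_list[OF assms] by blast
  let ?ys = "sort_key (out_degree G) xs"
  have "image_mset (out_degree G) (mset_set (verts G)) = mset (map (out_degree G) xs)"
    using xs by (simp add: mset_set_set[symmetric])
  also have "sorted_list_of_multiset \<dots> = sort (map (out_degree G) xs)"
    by (rule sorted_list_of_multiset_mset)
  also have "\<dots> = map (out_degree G) ?ys"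
    by (rule properties_for_sort) simp_all
  finally have "degree_sequence G = map (out_degree G) (rev ?ys)"
    by (simp add: degree_sequence_def rev_map)
  moreover have "sorted_wrt (\<ge>) (map (out_degree G) (rev ?ys))"
    by (simp add: rev_map[symmetric] sorted_wrt_rev)
  ultimately show ?thesis using that[of "rev ?ys"] xs by simp
qed

lemma Delta_1_2_bound_degrees:
  assumes "finite (verts G)" "2 \<le> card (verts G)"
  obtains v where "v \<in> verts G" "out_degree G v = Delta 1 G" "Delta 2 G \<le> Delta 1 G"
    "\<And>u. u \<in> verts G \<Longrightarrow> u \<noteq> v \<Longrightarrow> out_degree G u \<le> Delta 2 G"
proof -
  obtain vs where vs: "distinct vs" "set vs = verts G"
    "degree_sequence G = map (out_degree G) vs" "sorted_wrt (\<ge>) (map (out_degree G) vs)"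
    using degree_sequence_enumerates[OF assms(1)] by blast
  then have "2 \<le> length vs" using assms(2) by (metis distinct_card)
  then obtain v w ws where eq: "vs = v # w # ws"
    by (metis Suc_le_length_iff numeral_2_eq_2)
  show ?thesis
    by (rule that[of v]) (use vs(2-4) eq in \<open>auto simp: Delta_def\<close>)
qed

theorem theorem2p3:
  fixes F :: "('a, 'b) pre_digraph" and t :: nat
  assumes "2 \<le> t"
    and "undirected_forest F"
    and "2 \<le> card (verts F)"
    and "Delta 1 F + 2 * Delta 2 F \<le> ((t + 2) choose 2) + 2"
  shows "f_param 3 F \<le> t"
proof -
  interpret graph F using assms(2) by (simp add: undirected_forest_def)
  let ?N = "\<lambda>v. {w. v \<rightarrow>\<^bsub>F\<^esub> w}"
  interpret girth_at_least_five ?N using assms(2) by (rule forest_girth)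
  have deg: "deg_in ?N (verts F) u = out_degree F u" if "u \<in> verts F" for u
  proof -
    have "out_degree (delete_verts F {}) u = out_degree F u"
      by (simp add: delete_verts_def out_degree_def out_arcs_def) (metis head_in_verts tail_in_verts)
    then show ?thesis using out_degree_delete_verts[OF that, of "{}"] by simp
  qed
  obtain v where v: "v \<in> verts F" "out_degree F v = Delta 1 F" "Delta 2 F \<le> Delta 1 F"
    "\<And>u. u \<in> verts F \<Longrightarrow> u \<noteq> v \<Longrightarrow> out_degree F u \<le> Delta 2 F"
    using Delta_1_2_bound_degrees[OF finite_verts assms(3)] by blast
  obtain X where X: "X \<subseteq> verts F" "card X \<le> t" "three_max_or_small ?N (verts F - X)"
    using few_deletions_suffice[of "verts F" v "Delta 1 F" "Delta 2 F" t] v deg assms(1,4)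
    by auto
  have "f_param 3 F \<le> card X"
    unfolding f_param_def using X max_degree_repeated_iff by (intro Least_le) blast
  then show ?thesis using X(2) by simp
qed

end
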